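(* Let $\mathbf{V}(\boldsymbol\theta)=\theta_1\mathbf{L}_1+\cdots+\theta_\ell\mathbf{L}_\ell$, $\boldsymbol\theta\in\mathbb{R}^\ell$, be a linear covariance structure with symmetric $k\times k$ matrices $\mathbf{L}_1,\dots,\mathbf{L}_\ell$, and suppose that the $k^2\times\ell$ matrix $\mathbf{L}=[\mathrm{vec}(\mathbf{L}_1)\ \cdots\ \mathrm{vec}(\mathbf{L}_\ell)]$ has full column rank. Let $\mathbf{\Sigma}$ be a $k\times k$ positive definite symmetric matrix with $\mathbf{\Sigma}=\mathbf{V}(\boldsymbol\theta)$ for some $\boldsymbol\theta\in\mathbb{R}^\ell$. Let $\mathbf{N}$ be a $k\times k$ random matrix that is of radial type with respect to $\mathbf{\Sigma}$. Let $\Pi_L$ be the projection onto the column space of $\mathbf{L}$ scaled by $\mathbf{\Sigma}^{-1}\otimes\mathbf{\Sigma}^{-1}$, and define the random matrix $\mathbf{M}$ by $\mathrm{vec}(\mathbf{M})=\Pi_L\,\mathrm{vec}(\mathbf{N})$. (i) If the first two moments of $\mathbf{N}$ exist, then there exist constants $\eta,\sigma_1,\sigma_2$ with $\sigma_1\ge 0$ and $\sigma_2\ge -2\sigma_1/k$ such that $\mathbb{E}[\mathrm{vec}(\mathbf{M})]=\eta\,\mathrm{vec}(\mathbf{\Sigma})$ and $$\mathrm{var}\{\mathrm{vec}(\mathbf{M})\}=2\sigma_1\,\mathbf{L}\big(\mathbf{L}^T(\mathbf{\Sigma}^{-1}\otimes\mathbf{\Sigma}^{-1})\mathbf{L}\big)^{-1}\mathbf{L}^T+\sigma_2\,\mathrm{vec}(\mathbf{\Sigma})\mathrm{vec}(\mathbf{\Sigma})^T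 .$$ (ii) If $\mathbf{T}\in\mathbb{R}^\ell$ is the random vector such that $\mathrm{vec}(\mathbf{M})=\mathbf{L}\mathbf{T}$, then (with the same constants $\eta,\sigma_1,\sigma_2$ as in (i)) $\mathbb{E}[\mathbf{T}]=\eta\,\boldsymbol\theta$ and $$\mathrm{var}(\mathbf{T})=2\sigma_1\big(\mathbf{L}^T(\mathbf{\Sigma}^{-1}\otimes\mathbf{\Sigma}^{-1})\mathbf{L}\big)^{-1}+\sigma_2\,\boldsymbol\theta\boldsymbol\theta^T .$$
   Context: $\mathrm{vec}$ stacks the columns of a matrix; $\otimes$ is the Kronecker product; $\mathrm{var}$ of a random vector is its covariance matrix. A $k\times k$ random matrix $\mathbf{R}$ is of radial type if for every orthogonal matrix $\mathbf{O}$ the distribution of $\mathbf{O}\mathbf{R}\mathbf{O}^T$ equals that of $\mathbf{R}$. A random matrix $\mathbf{N}$ is of radial type with respect to the positive definite symmetric matrix $\mathbf{\Sigma}$ if $\mathbf{\Sigma}^{-1/2}\mathbf{N}\mathbf{\Sigma}^{-1/2}$ is of radial type. Scaled projection: for $\mathbf{x}\in\mathbb{R}^{k^2}$, $\Pi_L\mathbf{x}=\mathbf{L}\boldsymbol\theta^*$, where $\boldsymbol\theta^*$ minimizes $(\mathbf{x}-\mathbf{L}\boldsymbol\theta)^T(\mathbf{\Sigma}^{-1}\otimes\mathbf{\Sigma}^{-1})(\mathbf{x}-\mathbf{L}\boldsymbol\theta)$ over $\boldsymbol\theta\in\mathbb{R}^\ell$. Since $\mathbf{V}$ is linear, $\mathbf{L}_j=\partial\mathbf{V}/\partial\theta_j$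 and $\mathrm{vec}(\mathbf{\Sigma})=\mathbf{L}\boldsymbol\theta$. *)

theory Defs
  imports "HOL-Probability.Probability"
begin

(* Stacking of columns. The index set of the stacked vector consists of the pairs
   (column, row), the column being the outer (block) index. *)
definition vectorize :: "real^'n^'m \<Rightarrow> real^('n \<times> 'm)" where
  "vectorize A = (\<chi> p. A $ snd p $ fst p)"

(* The first component of a pair is the block index. Together with the index convention
   of vectorize this is the usual convention: vec (A X B) = (transpose B (x) A) vec X. *)
definition kronecker :: "real^'n^'m \<Rightarrow> real^'q^'p \<Rightarrow> real^('n \<times> 'q)^('m \<times> 'p)"
    (infixl "\<otimes>\<^sub>K" 70) where
  "A \<otimes>\<^sub>K B = (\<chi> a b. A $ fst a $ fst b * B $ snd a $ snd b)"

definition outer_product :: "real^'m \<Rightarrow> real^'n \<Rightarrow> real^'n^'m" where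
  "outer_product u v = (\<chi> i j. u $ i * v $ j)"

definition symmetric_matrix :: "real^'n^'n \<Rightarrow> bool" where
  "symmetric_matrix A \<longleftrightarrow> transpose A = A"

definition spd_matrix :: "real^'n^'n \<Rightarrow> bool" where
  "spd_matrix A \<longleftrightarrow> symmetric_matrix A \<and> (\<forall>x. x \<noteq> 0 \<longrightarrow> 0 < x \<bullet> (A *v x))"

(* Only meaningful for symmetric positive definite S. *)
definition inv_sqrt_matrix :: "real^'n^'n \<Rightarrow> real^'n^'n" where
  "inv_sqrt_matrix S = (THE B. spd_matrix B \<and> B ** B = matrix_inv S)"

definition radial_type :: "'w measure \<Rightarrow> ('w \<Rightarrow> real^'k^'k) \<Rightarrow> bool" where
  "radial_type P R \<longleftrightarrow>
     (\<forall>Q. orthogonal_matrix Q \<longrightarrow>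
        distr P borel (\<lambda>\<omega>. Q ** R \<omega> ** transpose Q) = distr P borel R)"

definition radial_type_wrt :: "'w measure \<Rightarrow> real^'k^'k \<Rightarrow> ('w \<Rightarrow> real^'k^'k) \<Rightarrow> bool" where
  "radial_type_wrt P S N \<longleftrightarrow>
     radial_type P (\<lambda>\<omega>. inv_sqrt_matrix S ** N \<omega> ** inv_sqrt_matrix S)"

definition first_two_moments_exist :: "'w measure \<Rightarrow> ('w \<Rightarrow> real^'n) \<Rightarrow> bool" where
  "first_two_moments_exist P X \<longleftrightarrow>
     (\<forall>a. integrable P (\<lambda>\<omega>. X \<omega> $ a)) \<and>
     (\<forall>a b. integrable P (\<lambda>\<omega>. X \<omega> $ a * X \<omega> $ b))"

definition mean_vector :: "'w measure \<Rightarrow> ('w \<Rightarrow> real^'n) \<Rightarrow> real^'n" where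
  "mean_vector P X = (\<chi> a. \<integral>\<omega>. X \<omega> $ a \<partial>P)"

definition covariance_matrix :: "'w measure \<Rightarrow> ('w \<Rightarrow> real^'n) \<Rightarrow> real^'n^'n" where
  "covariance_matrix P X =
     (\<chi> a b. \<integral>\<omega>. (X \<omega> $ a - mean_vector P X $ a) * (X \<omega> $ b - mean_vector P X $ b) \<partial>P)"

definition linear_structure :: "('l::finite \<Rightarrow> real^'k^'k) \<Rightarrow> real^'l \<Rightarrow> real^'k^'k" where
  "linear_structure Ls \<theta> = (\<Sum>j\<in>UNIV. (\<theta> $ j) *\<^sub>R Ls j)"

(* The matrix whose columns are vec (Ls j). *)
definition design_matrix :: "('l::finite \<Rightarrow> real^'k^'k) \<Rightarrow> real^'l^('k \<times> 'k)" where
  "design_matrix Ls = (\<chi> p j. vectorize (Ls j) $ p)"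

(* Projection onto the column space of L scaled by W. The minimizer is unique when L has
   full column rank and W is positive definite. *)
definition scaled_projection :: "real^'n^'n \<Rightarrow> real^'l^'n \<Rightarrow> real^'n \<Rightarrow> real^'n" where
  "scaled_projection W L x =
     L *v (ARG_MIN (\<lambda>\<theta>. (x - L *v \<theta>) \<bullet> (W *v (x - L *v \<theta>))) \<theta>. True)"

end

theory Submission
  imports Defs
begin

text \<open>
  With \<open>B = \<Sigma>\<^sup>-\<^sup>1\<^sup>/\<^sup>2\<close>, the matrix \<open>R = B N B\<close> is of radial type, so \<open>A \<mapsto> E \<langle>A, R\<rangle>\<close> and
  \<open>(A, A') \<mapsto> Cov (\<langle>A, R\<rangle>, \<langle>A', R\<rangle>)\<close> are invariant under orthogonal conjugation. On symmetric
  matrices such forms are \<open>\<eta> tr A\<close> and \<open>2 \<sigma>1 \<langle>A, A'\<rangle> + \<sigma>2 tr A tr A'\<close>. By the normal equations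
  \<open>T = G\<^sup>-\<^sup>1 L\<^sup>T W vec N\<close> with \<open>G = L\<^sup>T W L\<close>, and \<open>L\<^sup>T W vec N\<close> has the components \<open>\<langle>K\<^sub>j, R\<rangle>\<close> for the
  symmetric matrices \<open>K\<^sub>j = B L\<^sub>j B\<close>. Since \<open>\<langle>K\<^sub>i, K\<^sub>j\<rangle> = G\<^sub>i\<^sub>j\<close> and \<open>tr K\<^sub>j = (G \<theta>)\<^sub>j\<close>, the mean and
  covariance of \<open>T\<close> follow by conjugating with \<open>G\<^sup>-\<^sup>1\<close>, and those of \<open>vec M = L T\<close> by conjugating with \<open>L\<close>.
\<close>

section \<open>Spectral theorem and positive definite square roots\<close>

lemma inner_matrix_vector_transpose:
  fixes A :: "real^'n^'m"
  shows "x \<bullet> (A *v y) = (transpose A *v x) \<bullet> y"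
  by (simp add: dot_lmul_matrix)

lemma symmetric_matrix_inner:
  "symmetric_matrix A \<Longrightarrow> x \<bullet> (A *v y) = (A *v x) \<bullet> y"
  by (metis inner_matrix_vector_transpose symmetric_matrix_def)

text \<open>Near 0 the quadratic term is dominated by the linear one, so a nonzero slope would break
  the bound. This is the first-order condition at the maximiser of the Rayleigh quotient.\<close>

lemma linear_le_quadratic_imp_zero:
  fixes a b :: real
  assumes "\<And>t. a * t \<le> b * t\<^sup>2"
  shows "a = 0"
proof (rule ccontr)
  assume "a \<noteq> 0"
  \<comment> \<open>A positive number strictly above \<open>b\<close>: at the test point
    \<open>a / c\<close> the linear term equals \<open>c * (a / c)\<^sup>2\<close>, which exceeds
    the right-hand side.\<close>
  define c where "c = \<bar>b\<bar> + 1"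
  have c: "c > 0" "b < c" by (auto simp: c_def)
  have "a * (a / c) \<le> b * (a / c)\<^sup>2" by (rule assms)
  also have "\<dots> < c * (a / c)\<^sup>2"
    using c \<open>a \<noteq> 0\<close> by (intro mult_strict_right_mono) auto
  also have "\<dots> = a * (a / c)"
    using c by (simp add: power2_eq_square)
  finally show False by simp
qed

text \<open>A maximiser of the Rayleigh quotient on an invariant subspace is an eigenvector.\<close>

lemma symmetric_eigenvector_in_subspace:
  fixes A :: "real^'n^'n"
  assumes sym: "symmetric_matrix A" and S: "subspace S" "\<And>x. x \<in> S \<Longrightarrow> A *v x \<in> S"
    and "z \<in> S" "z \<noteq> 0"
  obtains v c where "v \<in> S" "norm v = 1" "A *v v = c *\<^sub>R v"
proof -
  let ?K = "S \<inter> sphere 0 1"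
  have "compact ?K"
    by (rule closed_Int_compact[OF closed_subspace[OF S(1)] compact_sphere])
  moreover have "(1 / norm z) *\<^sub>R z \<in> ?K"
    using assms by (auto simp: subspace_scale)
  then have "?K \<noteq> {}" by blast
  moreover have "continuous_on ?K (\<lambda>x. x \<bullet> (A *v x))"
    by (intro continuous_intros linear_continuous_on) (simp add: linear_linear)
  ultimately obtain v where "v \<in> ?K" and "\<forall>x\<in>?K. x \<bullet> (A *v x) \<le> v \<bullet> (A *v v)"
    using continuous_attains_sup[of ?K "\<lambda>x. x \<bullet> (A *v x)"] by blast
  then have v: "v \<in> S" "norm v = 1"
    and max: "\<And>x. x \<in> S \<Longrightarrow> norm x = 1 \<Longrightarrow> x \<bullet> (A *v x) \<le> v \<bullet> (A *v v)"
    by auto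
  define c where "c = v \<bullet> (A *v v)"
  \<comment> \<open>Homogeneity carries the maximum on the unit sphere over to all of
    \<open>S\<close>.\<close>
  have rayleigh: "x \<bullet> (A *v x) \<le> c * (x \<bullet> x)" if "x \<in> S" for x
  proof (cases "x = 0")
    case False
    let ?y = "(1 / norm x) *\<^sub>R x"
    have "?y \<bullet> (A *v ?y) \<le> c"
      unfolding c_def using False that S(1) by (intro max) (auto simp: subspace_scale)
    then have "(x \<bullet> (A *v x)) / (norm x)\<^sup>2 \<le> c"
      by (simp add: matrix_vector_mult_scaleR power2_eq_square)
    then show ?thesis
      using False by (simp add: field_simps dot_square_norm)
  qed simp
  \<comment> \<open>The residual of the eigenvalue equation. Moving from \<open>v\<close> in its
    direction changes the two sides of the Rayleigh bound, to first order in t, by amounts that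
    differ by \<open>2 * (?w \<bullet> ?w)\<close>, so the residual must vanish.\<close>
  let ?w = "A *v v - c *\<^sub>R v"
  have w: "?w \<in> S"
    using S v by (intro subspace_diff subspace_scale) auto
  have "(2 * (?w \<bullet> ?w)) * t \<le> (c * (?w \<bullet> ?w) - ?w \<bullet> (A *v ?w)) * t\<^sup>2" for t
  proof -
    have "v + t *\<^sub>R ?w \<in> S"
      using S v w by (intro subspace_add subspace_scale) auto
    from rayleigh[OF this]
    have le: "v \<bullet> (A *v v) + t * (v \<bullet> (A *v ?w)) + t * (?w \<bullet> (A *v v)) + t\<^sup>2 * (?w \<bullet> (A *v ?w))
        \<le> c * (v \<bullet> v + 2 * t * (v \<bullet> ?w) + t\<^sup>2 * (?w \<bullet> ?w))"
      by (simp only: matrix_vector_right_distrib matrix_vector_mult_scaleR inner_add_left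
          inner_add_right inner_scaleR_left inner_scaleR_right power2_eq_square
          inner_commute[of ?w v]) (simp only: algebra_simps)
    have "v \<bullet> v = 1" using v by (simp add: dot_square_norm)
    moreover have "v \<bullet> (A *v ?w) = ?w \<bullet> (A *v v)"
      by (metis sym symmetric_matrix_inner inner_commute)
    moreover have "?w \<bullet> (A *v v) = ?w \<bullet> ?w + c * (v \<bullet> ?w)"
      by (simp add: inner_diff_left inner_diff_right inner_commute algebra_simps)
    ultimately show ?thesis
      using le unfolding c_def[symmetric]
      by (simp only:) (simp only: algebra_simps)
  qed
  then have "2 * (?w \<bullet> ?w) = 0"
    by (rule linear_le_quadratic_imp_zero)
  then show thesis
    using that[of v c] v by simp
qed

definition diagonal_matrix :: "('n \<Rightarrow> real) \<Rightarrow> real^'n^'n" where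
  "diagonal_matrix d = (\<chi> i j. if i = j then d i else 0)"

lemma diagonal_matrix_mult_vec: "diagonal_matrix d *v x = (\<chi> i. d i * x $ i)"
  by (simp add: diagonal_matrix_def matrix_vector_mult_def vec_eq_iff if_distrib if_distribR
      cong: if_cong)

lemma transpose_diagonal_matrix [simp]: "transpose (diagonal_matrix d) = diagonal_matrix d"
  by (simp add: diagonal_matrix_def transpose_def vec_eq_iff)

lemma diagonal_matrix_mult:
  "diagonal_matrix d ** diagonal_matrix e = diagonal_matrix (\<lambda>i. d i * e i)"
  by (simp add: matrix_eq matrix_vector_mul_assoc[symmetric] diagonal_matrix_mult_vec mult.assoc)

text \<open>Induction on \<open>m\<close>: by symmetry of \<open>A\<close> the orthogonal complement
  of the eigenvectors found so far is invariant, so it contains a further unit eigenvector as long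
  as it is nonzero.\<close>

lemma symmetric_orthonormal_eigenvectors:
  fixes A :: "real^'n^'n"
  assumes sym: "symmetric_matrix A" and "m \<le> CARD('n)"
  shows "\<exists>B. finite B \<and> card B = m \<and> pairwise orthogonal B \<and>
    (\<forall>b\<in>B. norm b = 1 \<and> (\<exists>c. A *v b = c *\<^sub>R b))"
  using \<open>m \<le> CARD('n)\<close>
proof (induction m)
  case 0
  show ?case by (rule exI[of _ "{}"]) auto
next
  case (Suc m)
  then obtain B where B: "finite B" "card B = m" "pairwise orthogonal B"
    "\<And>b. b \<in> B \<Longrightarrow> norm b = 1" "\<And>b. b \<in> B \<Longrightarrow> \<exists>c. A *v b = c *\<^sub>R b"
    by auto
  \<comment> \<open>Fewer than n vectors do not span the space, which supplies a nonzero
    \<open>z\<close> in their orthogonal complement.\<close>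
  have "dim B < DIM(real^'n)"
    using dim_le_card'[OF B(1)] B(2) Suc.prems by simp
  then obtain z where z: "z \<noteq> 0" "\<And>y. y \<in> span B \<Longrightarrow> orthogonal z y"
    using orthogonal_to_subspace_exists[of B] by blast
  let ?S = "{y. \<forall>x\<in>B. orthogonal x y}"
  have inv: "A *v y \<in> ?S" if "y \<in> ?S" for y
  proof -
    have "x \<bullet> (A *v y) = 0" if "x \<in> B" for x
      using \<open>y \<in> ?S\<close> B(5)[OF that] that
      by (auto simp: symmetric_matrix_inner[OF sym] orthogonal_def)
    then show ?thesis by (simp add: orthogonal_def)
  qed
  have zS: "z \<in> ?S"
    using z(2) by (auto simp: span_base orthogonal_commute)
  obtain v c where v: "v \<in> ?S" "norm v = 1" "A *v v = c *\<^sub>R v"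
    by (rule symmetric_eigenvector_in_subspace[OF sym subspace_orthogonal_to_vectors[of B] inv zS z(1)])
  have "v \<notin> B"
    using v(1,2) by (auto simp: orthogonal_self)
  then show ?case
    using B v by (intro exI[of _ "insert v B"]) (auto simp: pairwise_insert orthogonal_commute)
qed

text \<open>The rows of \<open>Q\<close> are an orthonormal eigenbasis. The eigenvalue equations are
  then the columns of \<open>A ** transpose Q = transpose Q ** diagonal_matrix d\<close>, and
  multiplying by \<open>Q\<close> on the right isolates \<open>A\<close>.\<close>

theorem symmetric_matrix_diagonalizable:
  fixes A :: "real^'n^'n"
  assumes sym: "symmetric_matrix A"
  obtains Q d where "orthogonal_matrix Q" "A = transpose Q ** diagonal_matrix d ** Q"
proof -
  obtain B where B: "finite B" "card B = CARD('n)" "pairwise orthogonal B"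
    "\<And>b. b \<in> B \<Longrightarrow> norm b = 1" "\<And>b. b \<in> B \<Longrightarrow> \<exists>c. A *v b = c *\<^sub>R b"
    using symmetric_orthonormal_eigenvectors[OF sym order_refl] by blast
  obtain f where f: "bij_betw f (UNIV::'n set) B"
    using finite_same_card_bij[OF finite B(1)] B(2) by metis
  then have fB: "f i \<in> B" for i by (auto simp: bij_betw_def)
  have "\<forall>i. \<exists>c. A *v f i = c *\<^sub>R f i" using B(5) fB by blast
  then obtain d where d: "\<And>i. A *v f i = d i *\<^sub>R f i" by metis
  define Q where "Q = (\<chi> i j. f i $ j)"
  have row: "row i Q = f i" for i by (simp add: Q_def row_def)
  have "orthogonal (f i) (f j)" if "i \<noteq> j" for i j
    using B(3) f fB that unfolding pairwise_def bij_betw_def inj_on_def by blast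
  then have Q: "orthogonal_matrix Q"
    using B(4) fB by (auto simp: orthogonal_matrix_orthonormal_rows row)
  have "(A ** transpose Q) $ i $ j = (transpose Q ** diagonal_matrix d) $ i $ j" for i j
  proof -
    have "(A ** transpose Q) $ i $ j = (A *v f j) $ i"
      by (simp add: matrix_matrix_mult_def matrix_vector_mult_def Q_def transpose_def)
    also have "\<dots> = d j * f j $ i" by (simp add: d)
    also have "\<dots> = (transpose Q ** diagonal_matrix d) $ i $ j"
      by (simp add: matrix_matrix_mult_def diagonal_matrix_def Q_def transpose_def if_distrib
          cong: if_cong)
    finally show ?thesis .
  qed
  then have "A ** transpose Q = transpose Q ** diagonal_matrix d"
    by (simp add: vec_eq_iff)
  then have "A = transpose Q ** diagonal_matrix d ** Q"
    using Q by (metis matrix_mul_assoc matrix_mul_rid orthogonal_matrix)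
  with Q show thesis by (rule that)
qed

section \<open>Positive definite matrices, their inverses and square roots\<close>

lemma spd_matrix_symmetric: "spd_matrix A \<Longrightarrow> symmetric_matrix A"
  by (simp add: spd_matrix_def)

lemma matrix_inv_invertible:
  fixes A :: "real^'n^'n"
  assumes "invertible A"
  shows "A ** matrix_inv A = mat 1" "matrix_inv A ** A = mat 1"
proof -
  have "A ** matrix_inv A = mat 1 \<and> matrix_inv A ** A = mat 1"
    using assms unfolding matrix_inv_def invertible_def by (rule someI_ex)
  then show "A ** matrix_inv A = mat 1" "matrix_inv A ** A = mat 1" by auto
qed

lemma spd_matrix_invertible:
  assumes "spd_matrix A"
  shows "invertible A"
proof -
  have "x = 0" if "A *v x = 0" for x
    using assms that by (force simp: spd_matrix_def)
  then show ?thesis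
    by (metis invertible_left_inverse matrix_left_invertible_ker)
qed

lemma symmetric_matrix_inv:
  assumes "symmetric_matrix A" "invertible A"
  shows "symmetric_matrix (matrix_inv A)"
proof -
  let ?B = "matrix_inv A"
  note inv = matrix_inv_invertible[OF assms(2)]
  have "transpose ?B ** A = transpose (A ** ?B)"
    using assms(1) by (simp add: matrix_transpose_mul symmetric_matrix_def)
  then have "transpose ?B ** A = mat 1" by (simp add: inv)
  then have "(transpose ?B ** A) ** ?B = ?B" by simp
  moreover have "(transpose ?B ** A) ** ?B = transpose ?B ** (A ** ?B)"
    by (simp only: matrix_mul_assoc)
  ultimately show ?thesis by (simp add: inv symmetric_matrix_def)
qed

lemma spd_matrix_inv:
  assumes "spd_matrix A"
  shows "spd_matrix (matrix_inv A)"
  unfolding spd_matrix_def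
proof (intro conjI allI impI)
  note inv = matrix_inv_invertible[OF spd_matrix_invertible[OF assms]]
  show "symmetric_matrix (matrix_inv A)"
    by (simp add: assms spd_matrix_invertible spd_matrix_symmetric symmetric_matrix_inv)
  fix x :: "real^'a" assume "x \<noteq> 0"
  let ?y = "matrix_inv A *v x"
  have x: "A *v ?y = x" by (simp add: matrix_vector_mul_assoc inv)
  with \<open>x \<noteq> 0\<close> have "?y \<noteq> 0" by auto
  then have "0 < ?y \<bullet> (A *v ?y)" using assms by (simp add: spd_matrix_def)
  then show "0 < x \<bullet> ?y" by (simp add: x inner_commute)
qed

lemma inner_conjugated_diagonal:
  "x \<bullet> ((transpose Q ** diagonal_matrix d ** Q) *v x) = (\<Sum>i\<in>UNIV. d i * ((Q *v x) $ i)\<^sup>2)"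
proof -
  have "x \<bullet> ((transpose Q ** diagonal_matrix d ** Q) *v x)
      = x \<bullet> (transpose Q *v (diagonal_matrix d *v (Q *v x)))"
    by (simp only: matrix_vector_mul_assoc matrix_mul_assoc)
  also have "\<dots> = (Q *v x) \<bullet> (diagonal_matrix d *v (Q *v x))"
    by (simp only: inner_matrix_vector_transpose transpose_transpose)
  finally show ?thesis
    by (simp add: diagonal_matrix_mult_vec inner_vec_def power2_eq_square mult_ac)
qed

lemma orthogonal_matrix_mult_eq_0:
  "orthogonal_matrix Q \<Longrightarrow> Q *v x = (0::real^'n) \<Longrightarrow> x = 0"
  by (metis matrix_vector_mul_assoc matrix_vector_mul_lid matrix_vector_mult_0_right
      orthogonal_matrix)

text \<open>In the coordinates \<open>Q *v x\<close> the quadratic form is a weighted sum of squares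
  with weights \<open>d i\<close>. The preimage of a coordinate vector isolates a single
  weight.\<close>

lemma spd_conjugated_diagonal:
  assumes Q: "orthogonal_matrix Q"
  shows "spd_matrix (transpose Q ** diagonal_matrix d ** Q) \<longleftrightarrow> (\<forall>i. d i > 0)"
proof
  assume spd: "spd_matrix (transpose Q ** diagonal_matrix d ** Q)"
  show "\<forall>i. d i > 0"
  proof
    fix i
    let ?x = "transpose Q *v axis i 1"
    have Qx: "Q *v ?x = axis i 1"
      using Q by (simp only: matrix_vector_mul_assoc orthogonal_matrix_def matrix_vector_mul_lid)
    then have "?x \<noteq> 0" by (metis axis_eq_0_iff matrix_vector_mult_0_right zero_neq_one)
    then have "0 < ?x \<bullet> ((transpose Q ** diagonal_matrix d ** Q) *v ?x)"
      using spd unfolding spd_matrix_def by blast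
    also have "\<dots> = d i"
      unfolding inner_conjugated_diagonal Qx by (simp add: axis_def if_distrib[where f="\<lambda>x. x\<^sup>2"] if_distrib[where f="(*) _"] cong: if_cong)
    finally show "d i > 0" .
  qed
next
  assume d: "\<forall>i. d i > 0"
  show "spd_matrix (transpose Q ** diagonal_matrix d ** Q)"
    unfolding spd_matrix_def
  proof (intro conjI allI impI)
    show "symmetric_matrix (transpose Q ** diagonal_matrix d ** Q)"
      by (simp add: symmetric_matrix_def matrix_transpose_mul matrix_mul_assoc)
    fix x :: "real^'a" assume "x \<noteq> 0"
    then have "Q *v x \<noteq> 0" using orthogonal_matrix_mult_eq_0[OF Q] by blast
    then obtain i where "(Q *v x) $ i \<noteq> 0" by (metis vec_eq_iff zero_index)
    then have "0 < d i * ((Q *v x) $ i)\<^sup>2" using d by simp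
    then show "0 < x \<bullet> ((transpose Q ** diagonal_matrix d ** Q) *v x)"
      unfolding inner_conjugated_diagonal
      by (rule sum_pos2[OF finite UNIV_I]) (simp add: d less_imp_le)
  qed
qed

lemma spd_sqrt_exists:
  assumes "spd_matrix A"
  shows "\<exists>B. spd_matrix B \<and> B ** B = A"
proof -
  obtain Q d where Q: "orthogonal_matrix Q" and A: "A = transpose Q ** diagonal_matrix d ** Q"
    using symmetric_matrix_diagonalizable[OF spd_matrix_symmetric[OF assms]] by blast
  have d: "\<forall>i. d i > 0" using assms spd_conjugated_diagonal[OF Q] A by blast
  let ?D = "diagonal_matrix (\<lambda>i. sqrt (d i))"
  let ?B = "transpose Q ** ?D ** Q"
  have "?B ** ?B = transpose Q ** (?D ** (Q ** transpose Q) ** ?D) ** Q"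
    by (simp only: matrix_mul_assoc)
  also have "\<dots> = A"
    using Q d by (simp add: orthogonal_matrix_def diagonal_matrix_mult A less_imp_le)
  finally show ?thesis
    using d by (intro exI[of _ ?B]) (simp add: spd_conjugated_diagonal[OF Q])
qed

text \<open>If \<open>B\<^sup>2 = C\<^sup>2\<close> and \<open>D = B - C\<close>, then \<open>B D + D C = 0\<close>; pairing with an eigenvector of \<open>D\<close> shows
  that its eigenvalue vanishes.\<close>

lemma spd_sqrt_unique:
  assumes B: "spd_matrix B" and C: "spd_matrix C" and eq: "B ** B = C ** C"
  shows "B = C"
proof -
  have BC: "transpose B = B" "transpose C = C"
    using B C by (auto simp: spd_matrix_def symmetric_matrix_def)
  have "transpose (B - C) = B - C"
    using BC by (simp add: transpose_def vec_eq_iff)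
  then have sym: "symmetric_matrix (B - C)" by (simp add: symmetric_matrix_def)
  obtain Q d where Q: "orthogonal_matrix Q"
    and D: "B - C = transpose Q ** diagonal_matrix d ** Q"
    using symmetric_matrix_diagonalizable[OF sym] by blast
  have "d i = 0" for i
  proof -
    let ?x = "transpose Q *v axis i 1"
    have Qx: "Q *v ?x = axis i 1"
      using Q by (simp only: matrix_vector_mul_assoc orthogonal_matrix_def matrix_vector_mul_lid)
    then have x0: "?x \<noteq> 0" by (metis axis_eq_0_iff matrix_vector_mult_0_right zero_neq_one)
    have "(B - C) *v ?x = transpose Q *v (diagonal_matrix d *v (Q *v ?x))"
      by (simp only: D matrix_vector_mul_assoc matrix_mul_assoc)
    also have "diagonal_matrix d *v (Q *v ?x) = d i *\<^sub>R axis i 1"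
      unfolding Qx by (simp add: diagonal_matrix_mult_vec vec_eq_iff axis_def)
    finally have Dx: "(B - C) *v ?x = d i *\<^sub>R ?x"
      by (simp only: matrix_vector_mult_scaleR)
    \<comment> \<open>The splitting B B - C C = B (B - C) + (B - C) C holds without commutativity.
      Since \<open>?x\<close> is an eigenvector of the symmetric matrix B - C, both terms acquire
      the factor \<open>d i\<close>, and the cofactor is positive.\<close>
    have "0 = ?x \<bullet> ((B ** B) *v ?x) - ?x \<bullet> ((C ** C) *v ?x)" by (simp add: eq)
    also have "\<dots> = ?x \<bullet> (B *v ((B - C) *v ?x)) + ?x \<bullet> ((B - C) *v (C *v ?x))"
      by (simp only: matrix_vector_mul_assoc[symmetric] matrix_vector_mult_diff_rdistrib
          matrix_vector_mult_diff_distrib inner_diff_right)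
    also have "?x \<bullet> ((B - C) *v (C *v ?x)) = d i * (?x \<bullet> (C *v ?x))"
      by (simp only: symmetric_matrix_inner[OF sym] Dx inner_scaleR_left)
    also have "?x \<bullet> (B *v ((B - C) *v ?x)) = d i * (?x \<bullet> (B *v ?x))"
      by (simp only: Dx matrix_vector_mult_scaleR inner_scaleR_right)
    finally have "d i * (?x \<bullet> (B *v ?x) + ?x \<bullet> (C *v ?x)) = 0" by (simp only: distrib_left)
    moreover have "?x \<bullet> (B *v ?x) + ?x \<bullet> (C *v ?x) > 0"
      using B C x0 unfolding spd_matrix_def by (intro add_pos_pos) blast+
    ultimately show ?thesis by simp
  qed
  then have "diagonal_matrix d = 0" by (simp add: diagonal_matrix_def vec_eq_iff)
  with D show ?thesis by simp
qed

text \<open>Existence and uniqueness of the square root make the definite description in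
  \<open>inv_sqrt_matrix\<close> meaningful.\<close>

lemma inv_sqrt_matrix:
  assumes "spd_matrix A"
  shows "spd_matrix (inv_sqrt_matrix A)" "inv_sqrt_matrix A ** inv_sqrt_matrix A = matrix_inv A"
proof -
  have "\<exists>!B. spd_matrix B \<and> B ** B = matrix_inv A"
    using spd_sqrt_exists[OF spd_matrix_inv[OF assms]] by (metis spd_sqrt_unique)
  from theI'[OF this] show "spd_matrix (inv_sqrt_matrix A)"
    "inv_sqrt_matrix A ** inv_sqrt_matrix A = matrix_inv A"
    by (auto simp: inv_sqrt_matrix_def)
qed

section \<open>Orthogonally invariant forms\<close>

lemma matrix_add_rdistrib: "(A + B) ** C = A ** C + B ** C"
  for A B :: "real^'n^'m"
  by (simp add: vec_eq_iff matrix_matrix_mult_def distrib_right sum.distrib)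

lemma matrix_add_conjugate:
  "A ** (c *\<^sub>R C + d *\<^sub>R D) ** B = c *\<^sub>R (A ** C ** B) + d *\<^sub>R (A ** D ** B)"
  for A :: "real^'n^'m"
  by (simp add: matrix_add_ldistrib matrix_add_rdistrib matrix_scalar_ac scalar_matrix_assoc)

text \<open>The componentwise inner product is the Frobenius product; in trace form, matrix factors
  can be moved from one argument to the other.\<close>

lemma inner_eq_trace: "A \<bullet> B = trace (transpose A ** B)"
  for A B :: "real^'n^'m"
  by (simp add: inner_vec_def trace_def matrix_matrix_mult_def transpose_def) (rule sum.swap)

lemma inner_matrix_mult_left: "X \<bullet> (A ** Y) = (transpose A ** X) \<bullet> Y"
  for A :: "real^'n^'m"
  by (simp add: inner_eq_trace matrix_transpose_mul matrix_mul_assoc)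

lemma inner_matrix_mult_right: "X \<bullet> (Y ** A) = (X ** transpose A) \<bullet> Y"
  for A :: "real^'n^'m"
proof -
  have "trace (transpose X ** (Y ** A)) = trace ((transpose X ** Y) ** A)"
    by (simp only: matrix_mul_assoc)
  also have "\<dots> = trace (A ** (transpose X ** Y))"
    by (rule trace_mul_sym)
  finally show ?thesis
    by (simp add: inner_eq_trace matrix_transpose_mul matrix_mul_assoc)
qed

lemma inner_mat_1: "A \<bullet> mat 1 = trace A"
  for A :: "real^'n^'n"
  by (simp add: inner_vec_def trace_def mat_def if_distrib cong: if_cong)

lemma inner_orthogonal_conjugate:
  fixes A B :: "real^'n^'n"
  assumes "orthogonal_matrix Q"
  shows "(transpose Q ** A ** Q) \<bullet> (transpose Q ** B ** Q) = A \<bullet> B"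
proof -
  have "(transpose Q ** A ** Q) \<bullet> (transpose Q ** B ** Q)
      = (Q ** transpose Q ** A ** (Q ** transpose Q)) \<bullet> B"
    by (simp only: inner_matrix_mult_right[of _ "transpose Q ** B" Q]
        inner_matrix_mult_left[of _ "transpose Q" B] transpose_transpose matrix_mul_assoc)
  then show ?thesis using assms by (simp add: orthogonal_matrix_def)
qed

lemma trace_orthogonal_conjugate:
  fixes A :: "real^'n^'n"
  assumes "orthogonal_matrix Q"
  shows "trace (transpose Q ** A ** Q) = trace A"
proof -
  have "trace (transpose Q ** A ** Q) = trace (Q ** (transpose Q ** A))"
    by (rule trace_mul_sym)
  then show ?thesis using assms by (simp add: matrix_mul_assoc orthogonal_matrix_def)
qed

lemma trace_diagonal_matrix: "trace (diagonal_matrix d) = sum d UNIV"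
  by (simp add: trace_def diagonal_matrix_def)

lemma inner_diagonal_matrix: "diagonal_matrix d \<bullet> diagonal_matrix e = (\<Sum>i\<in>UNIV. d i * e i)"
  by (simp add: inner_vec_def diagonal_matrix_def if_distrib if_distribR cong: if_cong)

section \<open>Diagonal matrix units, permutation matrices and the classification of invariant
  forms\<close>

abbreviation matrix_unit :: "'n \<Rightarrow> real^'n^'n" where
  "matrix_unit i \<equiv> diagonal_matrix (\<lambda>j. if j = i then 1 else 0)"

lemma diagonal_matrix_expand: "diagonal_matrix d = (\<Sum>i\<in>UNIV. d i *\<^sub>R matrix_unit i)"
proof -
  have "(\<Sum>k\<in>UNIV. d k *\<^sub>R matrix_unit k) $ i $ j = diagonal_matrix d $ i $ j" for i j
  proof -
    have "(\<Sum>k\<in>UNIV. d k *\<^sub>R matrix_unit k) $ i $ j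
        = (\<Sum>k\<in>UNIV. if k = i then (if i = j then d i else 0) else 0)"
      unfolding sum_component by (intro sum.cong) (auto simp: diagonal_matrix_def)
    then show ?thesis by (simp add: diagonal_matrix_def)
  qed
  then show ?thesis by (simp add: vec_eq_iff)
qed

text \<open>Serves two purposes: permuting the matrix units, and carrying the rank-one term of a
  covariance matrix through a linear map.\<close>

lemma outer_product_conjugate:
  "A ** outer_product u v ** transpose B = outer_product (A *v u) (B *v v)"
proof -
  have outer: "outer_product a b *v x = (b \<bullet> x) *\<^sub>R a" for a :: "real^'i" and b x :: "real^'j"
    by (simp add: vec_eq_iff outer_product_def matrix_vector_mult_def inner_vec_def
        sum_distrib_left sum_distrib_right mult_ac)
  have "(A ** outer_product u v ** transpose B) *v x = outer_product (A *v u) (B *v v) *v x" for x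
  proof -
    have "(A ** outer_product u v ** transpose B) *v x
        = A *v (outer_product u v *v (transpose B *v x))"
      by (simp only: matrix_vector_mul_assoc matrix_mul_assoc)
    also have "\<dots> = (v \<bullet> (transpose B *v x)) *\<^sub>R (A *v u)"
      by (simp only: outer matrix_vector_mult_scaleR)
    also have "v \<bullet> (transpose B *v x) = (B *v v) \<bullet> x"
      by (simp only: inner_matrix_vector_transpose transpose_transpose)
    finally show ?thesis by (simp only: outer)
  qed
  then show ?thesis by (simp add: matrix_eq)
qed

lemma outer_product_axis: "outer_product (axis i 1) (axis i 1) = matrix_unit i"
  by (auto simp: vec_eq_iff outer_product_def axis_def diagonal_matrix_def)

text \<open>A matrix unit is the outer square of a coordinate vector, and the transposed permutation
  matrix sends the i-th coordinate vector to the \<open>p i\<close>-th. On a finite index type an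
  injection is a permutation.\<close>

lemma matrix_unit_permute:
  fixes p :: "'n::finite \<Rightarrow> 'n"
  assumes "inj p"
  obtains Q :: "real^'n^'n" where "orthogonal_matrix Q"
    "\<And>i. transpose Q ** matrix_unit i ** Q = matrix_unit (p i)"
proof -
  define Q :: "real^'n^'n" where "Q = (\<chi> i. axis (p i) 1)"
  have row: "row i Q = axis (p i) 1" for i
    by (simp add: row_def Q_def vec_eq_iff)
  have "orthogonal_matrix Q"
    using assms
    by (auto simp: orthogonal_matrix_orthonormal_rows row orthogonal_def inner_axis_axis inj_eq)
  moreover have "transpose Q ** matrix_unit i ** Q = matrix_unit (p i)" for i
  proof -
    have "transpose Q *v axis i 1 = axis (p i) 1"
      by (simp only: matrix_vector_mult_basis column_transpose row)
    then show ?thesis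
      using outer_product_conjugate[of "transpose Q" "axis i 1" "axis i 1" "transpose Q"]
      by (simp only: outer_product_axis transpose_transpose)
  qed
  ultimately show thesis by (rule that)
qed

text \<open>Transpositions of indices force one common value on all matrix units, and the spectral
  theorem reduces a symmetric matrix to a combination of these. That common value is the constant
  \<eta>.\<close>

lemma invariant_linear_form:
  fixes m :: "real^'n^'n \<Rightarrow> real"
  assumes lin: "linear m"
    and inv: "\<And>Q A. orthogonal_matrix Q \<Longrightarrow> m (transpose Q ** A ** Q) = m A"
  shows "\<exists>\<eta>. \<forall>A. symmetric_matrix A \<longrightarrow> m A = \<eta> * trace A"
proof -
  fix k :: 'n
  have unit: "m (matrix_unit i) = m (matrix_unit k)" for i
  proof -
    obtain Q where Q: "orthogonal_matrix Q"
      "\<And>j. transpose Q ** matrix_unit j ** Q = matrix_unit (Transposition.transpose i k j)"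
      using matrix_unit_permute[OF inj_on_transpose] by metis
    show ?thesis using inv[OF Q(1), of "matrix_unit i"] Q(2)[of i] by simp
  qed
  have "m A = m (matrix_unit k) * trace A" if "symmetric_matrix A" for A
  proof -
    obtain Q d where Q: "orthogonal_matrix Q" and A: "A = transpose Q ** diagonal_matrix d ** Q"
      using symmetric_matrix_diagonalizable[OF \<open>symmetric_matrix A\<close>] by blast
    have "m A = m (diagonal_matrix d)" by (simp add: A inv Q)
    also have "\<dots> = (\<Sum>i\<in>UNIV. d i * m (matrix_unit i))"
      by (subst diagonal_matrix_expand) (simp add: linear_sum[OF lin] linear_scale[OF lin])
    also have "\<dots> = m (matrix_unit k) * trace A"
      by (subst unit)
        (simp add: A trace_orthogonal_conjugate[OF Q] trace_diagonal_matrix sum_distrib_right mult.commute)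
    finally show ?thesis .
  qed
  then show ?thesis by blast
qed

lemma two_point_permutation:
  assumes "i \<noteq> j" "k \<noteq> l"
  obtains p :: "'n \<Rightarrow> 'n" where "inj p" "p i = k" "p j = l"
proof
  \<comment> \<open>The first transposition takes \<open>i\<close> to \<open>k\<close>; the second
    moves the image of \<open>j\<close> to \<open>l\<close> and fixes \<open>k\<close>, which
    differs from both.\<close>
  let ?f = "Transposition.transpose i k"
  let ?p = "Transposition.transpose (?f j) l \<circ> ?f"
  show "inj ?p" by (intro inj_compose inj_on_transpose)
  show "?p j = l" by simp
  have "?f j \<noteq> k" using assms(1) by (metis transpose_apply_first transpose_involutory)
  then show "?p i = k" using assms(2) by simp
qed

text \<open>By the spectral theorem an invariant form is determined by its values on diagonal matrices, and
  invariance under permutation matrices leaves two free values: one for \<open>i = j\<close>, one for \<open>i \<noteq> j\<close>.\<close>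

lemma invariant_bilinear_form:
  fixes c :: "real^'n^'n \<Rightarrow> real^'n^'n \<Rightarrow> real"
  assumes bil: "bilinear c" and sym: "\<And>A B. c A B = c B A"
    and nonneg: "\<And>A. c A A \<ge> 0"
    and inv: "\<And>Q A B. orthogonal_matrix Q \<Longrightarrow>
      c (transpose Q ** A ** Q) (transpose Q ** B ** Q) = c A B"
  shows "\<exists>\<alpha> \<beta>. \<alpha> \<ge> 0 \<and> \<alpha> + real CARD('n) * \<beta> \<ge> 0 \<and>
    (\<forall>A B. symmetric_matrix A \<longrightarrow> symmetric_matrix B \<longrightarrow>
      c A B = \<alpha> * (A \<bullet> B) + \<beta> * (trace A * trace B))"
proof -
  let ?E = matrix_unit
  have perm: "c (?E (p i)) (?E (p j)) = c (?E i) (?E j)" if "inj p" for p i j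
    using matrix_unit_permute[OF that] inv by metis
  fix k :: 'n
  have diag: "c (?E i) (?E i) = c (?E k) (?E k)" for i
    using perm[OF inj_on_transpose[of i k UNIV], of i i] by simp
  have "\<exists>\<alpha> \<beta>. \<alpha> \<ge> 0 \<and> (\<forall>i j. c (?E i) (?E j) = \<beta> + (if i = j then \<alpha> else 0))"
  proof (cases "\<exists>l. l \<noteq> k")
    case True
    then obtain l where l: "k \<noteq> l" by metis
    have off: "c (?E i) (?E j) = c (?E k) (?E l)" if ij: "i \<noteq> j" for i j
    proof -
      obtain p where "inj p" "p i = k" "p j = l"
        by (rule two_point_permutation[OF ij l])
      then show ?thesis using perm[of p i j] by simp
    qed
    \<comment> \<open>Here \<alpha> is the diagonal value minus the off-diagonal one, and \<beta> is
      the off-diagonal value; nonnegativity on this difference is exactly \<alpha> \<ge> 0.\<close>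
    have "0 \<le> c (?E k - ?E l) (?E k - ?E l)" by (rule nonneg)
    also have "\<dots> = 2 * (c (?E k) (?E k) - c (?E k) (?E l))"
      by (simp add: bilinear_lsub[OF bil] bilinear_rsub[OF bil] diag[of l] sym[of "?E l" "?E k"])
    finally show ?thesis
      using diag off
      by (intro exI[of _ "c (?E k) (?E k) - c (?E k) (?E l)"] exI[of _ "c (?E k) (?E l)"]) auto
  next
    case False
    \<comment> \<open>In dimension one there is no off-diagonal pair: \<alpha> is 0 and \<beta> is
      the only value of the form on units.\<close>
    then have "i = k" for i by blast
    then have "c (?E i) (?E j) = c (?E k) (?E k)" for i j
      by (intro arg_cong2[of _ _ _ _ c] arg_cong[of _ _ ?E])
    then have "\<forall>i j. c (?E i) (?E j) = c (?E k) (?E k) + (if i = j then 0 else 0)"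
      by simp
    then show ?thesis by blast
  qed
  then obtain \<alpha> \<beta> where \<alpha>: "\<alpha> \<ge> 0"
    and unit: "\<And>i j. c (?E i) (?E j) = \<beta> + (if i = j then \<alpha> else 0)"
    by blast
  have quadratic: "c A A = \<alpha> * (A \<bullet> A) + \<beta> * (trace A * trace A)" if "symmetric_matrix A" for A
  proof -
    obtain Q d where Q: "orthogonal_matrix Q" and A: "A = transpose Q ** diagonal_matrix d ** Q"
      using symmetric_matrix_diagonalizable[OF \<open>symmetric_matrix A\<close>] by blast
    have "c A A = c (diagonal_matrix d) (diagonal_matrix d)" by (simp add: A inv Q)
    also have "\<dots> = (\<Sum>(i, j)\<in>UNIV \<times> UNIV. c (d i *\<^sub>R ?E i) (d j *\<^sub>R ?E j))"
      by (subst (1 2) diagonal_matrix_expand) (rule bilinear_sum[OF bil])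
    also have "\<dots> = (\<Sum>i\<in>UNIV. \<Sum>j\<in>UNIV. d i * (d j * c (?E i) (?E j)))"
      by (simp add: bilinear_lmul[OF bil] bilinear_rmul[OF bil] sum.cartesian_product
          mult.left_commute)
    also have "\<dots> = (\<Sum>i\<in>UNIV. \<Sum>j\<in>UNIV. \<beta> * (d i * d j) + (if i = j then \<alpha> * (d i * d j) else 0))"
      by (intro sum.cong refl) (simp add: unit algebra_simps)
    also have "\<dots> = \<beta> * (\<Sum>i\<in>UNIV. \<Sum>j\<in>UNIV. d i * d j) + \<alpha> * (\<Sum>i\<in>UNIV. d i * d i)"
      by (simp add: sum.distrib sum_distrib_left)
    also have "(\<Sum>i\<in>UNIV. \<Sum>j\<in>UNIV. d i * d j) = sum d UNIV * sum d UNIV"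
      by (simp add: sum_product)
    finally show ?thesis
      by (simp add: A inner_orthogonal_conjugate[OF Q] trace_orthogonal_conjugate[OF Q]
          inner_diagonal_matrix trace_diagonal_matrix)
  qed
  \<comment> \<open>Two symmetric matrices need not be diagonalised by the same \<open>Q\<close>, so
    the bilinear identity comes by polarisation from the quadratic one.\<close>
  have bilin: "c A B = \<alpha> * (A \<bullet> B) + \<beta> * (trace A * trace B)"
    if "symmetric_matrix A" "symmetric_matrix B" for A B
  proof -
    have "transpose (A + B) = transpose A + transpose B"
      by (simp add: transpose_def vec_eq_iff)
    then have "symmetric_matrix (A + B)"
      using that by (simp add: symmetric_matrix_def)
    from quadratic[OF this] quadratic[OF that(1)] quadratic[OF that(2)]
    show ?thesis
      by (simp add: bilinear_ladd[OF bil] bilinear_radd[OF bil] sym[of B A] trace_add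
          inner_add_left inner_add_right inner_commute[of B A] algebra_simps)
  qed
  \<comment> \<open>Nonnegativity at the identity matrix, of squared norm n and trace n, gives the
    lower bound on \<beta>.\<close>
  have "symmetric_matrix (mat 1 :: real^'n^'n)" by (simp add: symmetric_matrix_def)
  from quadratic[OF this] nonneg[of "mat 1"]
  have "0 \<le> real CARD('n) * (\<alpha> + real CARD('n) * \<beta>)"
    by (simp add: inner_mat_1 trace_I algebra_simps)
  then have "\<alpha> + real CARD('n) * \<beta> \<ge> 0"
    by (simp add: zero_le_mult_iff)
  with \<alpha> bilin show ?thesis by blast
qed

section \<open>Vectorization and weighted least squares\<close>

lemma inner_vectorize: "vectorize A \<bullet> vectorize B = A \<bullet> B"
proof -
  have "vectorize A \<bullet> vectorize B = (\<Sum>(j, i)\<in>UNIV \<times> UNIV. A $ i $ j * B $ i $ j)"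
    by (simp add: inner_vec_def vectorize_def case_prod_beta)
  also have "\<dots> = (\<Sum>j\<in>UNIV. \<Sum>i\<in>UNIV. A $ i $ j * B $ i $ j)"
    by (rule sum.cartesian_product[symmetric])
  also have "\<dots> = A \<bullet> B"
    by (simp add: inner_vec_def) (rule sum.swap)
  finally show ?thesis .
qed

lemma kronecker_mult_vectorize:
  "(A \<otimes>\<^sub>K B) *v vectorize X = vectorize (B ** X ** transpose A)"
proof -
  have "((A \<otimes>\<^sub>K B) *v vectorize X) $ p = vectorize (B ** X ** transpose A) $ p" for p
  proof -
    have "((A \<otimes>\<^sub>K B) *v vectorize X) $ p
        = (\<Sum>(a, b)\<in>UNIV \<times> UNIV. A $ fst p $ a * B $ snd p $ b * X $ b $ a)"
      by (simp add: matrix_vector_mult_def kronecker_def vectorize_def case_prod_beta)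
    also have "\<dots> = (\<Sum>a\<in>UNIV. \<Sum>b\<in>UNIV. A $ fst p $ a * B $ snd p $ b * X $ b $ a)"
      by (rule sum.cartesian_product[symmetric])
    also have "\<dots> = vectorize (B ** X ** transpose A) $ p"
      by (simp add: matrix_matrix_mult_def vectorize_def transpose_def sum_distrib_left
          sum_distrib_right mult_ac)
    finally show ?thesis .
  qed
  then show ?thesis by (simp add: vec_eq_iff)
qed

lemma transpose_kronecker: "transpose (A \<otimes>\<^sub>K B) = transpose A \<otimes>\<^sub>K transpose B"
  by (simp add: vec_eq_iff transpose_def kronecker_def)

lemma vectorize_surj: "\<exists>X. x = vectorize X"
  by (rule exI[of _ "\<chi> i j. x $ (j, i)"]) (simp add: vectorize_def vec_eq_iff)

lemma vectorize_linear: "linear vectorize"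
  by (rule linearI) (simp_all add: vectorize_def vec_eq_iff)

text \<open>Every vector is a vectorized matrix, and on those both sides act as the same two-sided
  multiplication.\<close>

lemma kronecker_mult: "(A \<otimes>\<^sub>K B) ** (C \<otimes>\<^sub>K D) = (A ** C) \<otimes>\<^sub>K (B ** D)"
proof -
  have "((A \<otimes>\<^sub>K B) ** (C \<otimes>\<^sub>K D)) *v x = ((A ** C) \<otimes>\<^sub>K (B ** D)) *v x" for x
  proof -
    obtain X where "x = vectorize X" using vectorize_surj by blast
    then show ?thesis
      by (simp add: matrix_vector_mul_assoc[symmetric] kronecker_mult_vectorize
          matrix_transpose_mul matrix_mul_assoc)
  qed
  then show ?thesis by (simp add: matrix_eq)
qed

lemma design_matrix_mult: "design_matrix Ls *v \<theta> = vectorize (linear_structure Ls \<theta>)"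
  by (simp add: vec_eq_iff design_matrix_def matrix_vector_mult_def vectorize_def
      linear_structure_def mult.commute)

lemma transpose_design_matrix_mult:
  "(transpose (design_matrix Ls) *v vectorize X) $ j = Ls j \<bullet> X"
proof -
  have "(transpose (design_matrix Ls) *v vectorize X) $ j = vectorize (Ls j) \<bullet> vectorize X"
    unfolding matrix_vector_mul_component
    by (rule arg_cong[of _ _ "\<lambda>z. z \<bullet> _"]) (simp add: vec_eq_iff transpose_def design_matrix_def)
  then show ?thesis by (simp add: inner_vectorize)
qed

section \<open>Gram matrix and normal equations of the scaled projection\<close>

lemma spd_gram:
  fixes W :: "real^'n^'n" and L :: "real^'l^'n"
  assumes W: "spd_matrix W" and L: "inj ((*v) L)"
  shows "spd_matrix (transpose L ** W ** L)"
  unfolding spd_matrix_def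
proof (intro conjI allI impI)
  show "symmetric_matrix (transpose L ** W ** L)"
    using W by (simp add: spd_matrix_def symmetric_matrix_def matrix_transpose_mul matrix_mul_assoc)
  fix x :: "real^'l" assume "x \<noteq> 0"
  then have "L *v x \<noteq> 0" using L by (metis injD matrix_vector_mult_0_right)
  then have "0 < (L *v x) \<bullet> (W *v (L *v x))" using W by (simp add: spd_matrix_def)
  also have "\<dots> = x \<bullet> (transpose L *v (W *v (L *v x)))"
    by (simp only: inner_matrix_vector_transpose transpose_transpose)
  finally show "0 < x \<bullet> ((transpose L ** W ** L) *v x)"
    by (simp only: matrix_vector_mul_assoc matrix_mul_assoc)
qed

text \<open>Pythagoras in the inner product given by \<open>W\<close>: the residual at the solution
  \<open>t\<close> of the normal equations is orthogonal to the column space, so any other parameter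
  increases the objective strictly.\<close>

lemma scaled_projection_normal_equations:
  fixes W :: "real^'n^'n" and L :: "real^'l^'n"
  assumes W: "spd_matrix W" and L: "inj ((*v) L)"
  shows "scaled_projection W L x =
    L *v (matrix_inv (transpose L ** W ** L) *v (transpose L *v (W *v x)))"
proof -
  let ?G = "transpose L ** W ** L"
  define t where "t = matrix_inv ?G *v (transpose L *v (W *v x))"
  define f where "f = (\<lambda>s. (x - L *v s) \<bullet> (W *v (x - L *v s)))"
  have "?G *v t = (?G ** matrix_inv ?G) *v (transpose L *v (W *v x))"
    by (simp only: t_def matrix_vector_mul_assoc matrix_mul_assoc)
  then have "?G *v t = transpose L *v (W *v x)"
    by (simp only: matrix_inv_invertible[OF spd_matrix_invertible[OF spd_gram[OF W L]]]
        matrix_vector_mul_lid)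
  then have "transpose L *v (W *v (L *v t)) = transpose L *v (W *v x)"
    by (simp only: matrix_vector_mul_assoc matrix_mul_assoc)
  then have normal: "transpose L *v (W *v (x - L *v t)) = 0"
    by (simp only: matrix_vector_mult_diff_distrib) simp
  have less: "f t < f s" if "s \<noteq> t" for s
  proof -
    let ?r = "x - L *v t" and ?d = "L *v (t - s)"
    have "t - s \<noteq> 0" using that by simp
    then have "?d \<noteq> 0" using L by (metis injD matrix_vector_mult_0_right)
    then have pos: "?d \<bullet> (W *v ?d) > 0" using W by (simp add: spd_matrix_def)
    have "?d \<bullet> (W *v ?r) = (t - s) \<bullet> (transpose L *v (W *v ?r))"
      by (simp only: inner_matrix_vector_transpose transpose_transpose)
    then have cross: "?d \<bullet> (W *v ?r) = 0" by (simp only: normal) simp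
    have cross': "?r \<bullet> (W *v ?d) = 0"
      using cross symmetric_matrix_inner[OF spd_matrix_symmetric[OF W]] by (metis inner_commute)
    have "x - L *v s = ?r + ?d" by (simp add: matrix_vector_mult_diff_distrib)
    then have "f s = (?r + ?d) \<bullet> (W *v (?r + ?d))" by (simp only: f_def)
    also have "\<dots> = f t + ?d \<bullet> (W *v ?d)"
      unfolding f_def using cross cross'
      by (simp only: matrix_vector_right_distrib inner_add_left inner_add_right)
    finally show ?thesis using pos by simp
  qed
  \<comment> \<open>\<open>arg_min\<close> chooses an arbitrary minimiser; strictness leaves
    \<open>t\<close> as the only candidate.\<close>
  have "is_arg_min f (\<lambda>_. True) s \<longleftrightarrow> s = t" for s
    unfolding is_arg_min_def using less by (metis less_asym less_irrefl)
  then have "arg_min f (\<lambda>_. True) = t" by (simp add: arg_min_def)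
  then show ?thesis by (simp only: scaled_projection_def f_def t_def)
qed

section \<open>Moments of random vectors and of matrices of radial type\<close>

lemma centered_product_integrable:
  fixes f g :: "'w \<Rightarrow> real"
  assumes "prob_space P" "integrable P f" "integrable P g" "integrable P (\<lambda>\<omega>. f \<omega> * g \<omega>)"
  shows "integrable P (\<lambda>\<omega>. (f \<omega> - a) * (g \<omega> - b))"
proof -
  interpret prob_space P by fact
  have "integrable P (\<lambda>\<omega>. f \<omega> * g \<omega> - b * f \<omega> - a * g \<omega> + a * b)"
    using assms by (intro Bochner_Integration.integrable_add Bochner_Integration.integrable_diff
        integrable_mult_right integrable_const)
  then show ?thesis by (simp add: algebra_simps)
qed

text \<open>The covariance matrix read as a bilinear form; as an integral it is visibly symmetric
  and nonnegative on the diagonal.\<close>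

lemma covariance_matrix_inner:
  fixes X :: "'w \<Rightarrow> real^'n"
  assumes P: "prob_space P" and X: "first_two_moments_exist P X"
  shows "x \<bullet> (covariance_matrix P X *v y) =
    (\<integral>\<omega>. (x \<bullet> (X \<omega> - mean_vector P X)) * (y \<bullet> (X \<omega> - mean_vector P X)) \<partial>P)"
proof -
  let ?Z = "\<lambda>\<omega> a. X \<omega> $ a - mean_vector P X $ a"
  have int: "integrable P (\<lambda>\<omega>. x $ a * (?Z \<omega> a * ?Z \<omega> b * y $ b))" for a b
    using X centered_product_integrable[OF P]
    by (intro integrable_mult_right integrable_mult_left) (auto simp: first_two_moments_exist_def)
  have "(x \<bullet> (X \<omega> - mean_vector P X)) * (y \<bullet> (X \<omega> - mean_vector P X))
      = (\<Sum>a\<in>UNIV. \<Sum>b\<in>UNIV. x $ a * (?Z \<omega> a * ?Z \<omega> b * y $ b))" for \<omega>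
    by (simp add: inner_vec_def sum_product mult_ac)
  then have "(\<integral>\<omega>. (x \<bullet> (X \<omega> - mean_vector P X)) * (y \<bullet> (X \<omega> - mean_vector P X)) \<partial>P)
      = (\<Sum>a\<in>UNIV. \<Sum>b\<in>UNIV. \<integral>\<omega>. x $ a * (?Z \<omega> a * ?Z \<omega> b * y $ b) \<partial>P)"
    by (simp only: Bochner_Integration.integral_sum Bochner_Integration.integrable_sum int)
  also have "\<dots> = (\<Sum>a\<in>UNIV. x $ a * (\<Sum>b\<in>UNIV. covariance_matrix P X $ a $ b * y $ b))"
    by (simp add: covariance_matrix_def sum_distrib_left)
  finally show ?thesis
    by (simp add: inner_vec_def matrix_vector_mult_def)
qed

lemma matrix_mult_conjugate_component:
  fixes A :: "real^'n^'m"
  shows "(A ** C ** transpose A) $ i $ j = A $ i \<bullet> (C *v A $ j)"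
proof -
  have "(A ** (C ** transpose A)) $ i $ j = (\<Sum>a\<in>UNIV. A $ i $ a * (C ** transpose A) $ a $ j)"
    by (simp add: matrix_matrix_mult_def)
  also have "\<dots> = A $ i \<bullet> (C *v A $ j)"
    by (simp add: inner_vec_def)
      (simp add: matrix_matrix_mult_def matrix_vector_mult_def transpose_def)
  finally show ?thesis by (simp only: matrix_mul_assoc)
qed

text \<open>Equality is asked only on \<open>space P\<close>, since \<open>M\<close> and
  \<open>T\<close> are determined only there.\<close>

lemma moments_matrix_vector_mult:
  fixes X :: "'w \<Rightarrow> real^'n" and A :: "real^'n^'m"
  assumes P: "prob_space P" and X: "first_two_moments_exist P X"
    and Y: "\<And>\<omega>. \<omega> \<in> space P \<Longrightarrow> Y \<omega> = A *v X \<omega>"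
  shows first_two_moments_matrix_vector_mult: "first_two_moments_exist P Y"
    and mean_vector_matrix_vector_mult: "mean_vector P Y = A *v mean_vector P X"
    and covariance_matrix_vector_mult:
      "covariance_matrix P Y = A ** covariance_matrix P X ** transpose A"
proof -
  have int: "integrable P (\<lambda>\<omega>. X \<omega> $ a)" "integrable P (\<lambda>\<omega>. X \<omega> $ a * X \<omega> $ b)" for a b
    using X by (auto simp: first_two_moments_exist_def)
  have Y1: "Y \<omega> $ i = (\<Sum>a\<in>UNIV. A $ i $ a * X \<omega> $ a)" if "\<omega> \<in> space P" for \<omega> i
    by (simp add: Y[OF that] matrix_vector_mult_def)
  have Y2: "Y \<omega> $ i * Y \<omega> $ j
      = (\<Sum>a\<in>UNIV. \<Sum>b\<in>UNIV. A $ i $ a * A $ j $ b * (X \<omega> $ a * X \<omega> $ b))"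
    if "\<omega> \<in> space P" for \<omega> i j
    by (simp add: Y1[OF that] sum_product mult_ac)
  have "integrable P (\<lambda>\<omega>. Y \<omega> $ i)" for i
    by (subst Bochner_Integration.integrable_cong[OF refl Y1], assumption)
      (intro Bochner_Integration.integrable_sum integrable_mult_right int)
  moreover have "integrable P (\<lambda>\<omega>. Y \<omega> $ i * Y \<omega> $ j)" for i j
    by (subst Bochner_Integration.integrable_cong[OF refl Y2], assumption)
      (intro Bochner_Integration.integrable_sum integrable_mult_right int)
  ultimately show "first_two_moments_exist P Y"
    by (simp add: first_two_moments_exist_def)
  have "mean_vector P Y $ i = (A *v mean_vector P X) $ i" for i
  proof -
    have "mean_vector P Y $ i = (\<integral>\<omega>. (\<Sum>a\<in>UNIV. A $ i $ a * X \<omega> $ a) \<partial>P)"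
      unfolding mean_vector_def by (simp add: Y1 cong: Bochner_Integration.integral_cong)
    also have "\<dots> = (\<Sum>a\<in>UNIV. A $ i $ a * (\<integral>\<omega>. X \<omega> $ a \<partial>P))"
      by (subst Bochner_Integration.integral_sum) (simp_all add: int)
    finally show ?thesis by (simp add: matrix_vector_mult_def mean_vector_def)
  qed
  then show mean: "mean_vector P Y = A *v mean_vector P X" by (simp add: vec_eq_iff)
  have "covariance_matrix P Y $ i $ j = (A ** covariance_matrix P X ** transpose A) $ i $ j" for i j
  proof -
    have "Y \<omega> $ k - mean_vector P Y $ k = A $ k \<bullet> (X \<omega> - mean_vector P X)"
      if "\<omega> \<in> space P" for \<omega> k
      by (simp only: Y[OF that] mean matrix_vector_mul_component inner_diff_right)
    then show ?thesis
      unfolding matrix_mult_conjugate_component covariance_matrix_inner[OF P X]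
      by (simp add: covariance_matrix_def cong: Bochner_Integration.integral_cong)
  qed
  then show "covariance_matrix P Y = A ** covariance_matrix P X ** transpose A"
    by (simp add: vec_eq_iff)
qed

lemma mean_covariance_distr_cong:
  fixes X Y :: "'w \<Rightarrow> real^'n"
  assumes X[measurable]: "X \<in> borel_measurable P" and Y[measurable]: "Y \<in> borel_measurable P"
    and eq: "distr P borel X = distr P borel Y"
  shows "mean_vector P X = mean_vector P Y" "covariance_matrix P X = covariance_matrix P Y"
proof -
  \<comment> \<open>Measurability of \<open>h\<close> is enough: a non-integrable integrand gives
    the default value 0 on both sides.\<close>
  have transfer: "(\<integral>\<omega>. h (X \<omega>) \<partial>P) = (\<integral>\<omega>. h (Y \<omega>) \<partial>P)"
    if h: "h \<in> borel_measurable borel" for h :: "real^'n \<Rightarrow> real"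
    using integral_distr[OF X h] integral_distr[OF Y h] eq by simp
  have comp[measurable]: "(\<lambda>x. x $ a) \<in> borel_measurable borel" for a :: 'n
    by (intro borel_measurable_continuous_onI continuous_intros)
  show mean: "mean_vector P X = mean_vector P Y"
    unfolding mean_vector_def using transfer[OF comp] by simp
  \<comment> \<open>Once the means are identified, both integrands are the same fixed function of
    the random vector.\<close>
  show "covariance_matrix P X = covariance_matrix P Y"
    unfolding covariance_matrix_def mean
  proof (intro arg_cong[of _ _ vec_lambda] ext)
    fix a b
    show "(\<integral>\<omega>. (X \<omega> $ a - mean_vector P Y $ a) * (X \<omega> $ b - mean_vector P Y $ b) \<partial>P)
        = (\<integral>\<omega>. (Y \<omega> $ a - mean_vector P Y $ a) * (Y \<omega> $ b - mean_vector P Y $ b) \<partial>P)"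
      by (rule transfer[of "\<lambda>x. (x $ a - mean_vector P Y $ a) * (x $ b - mean_vector P Y $ b)"])
        measurable
  qed
qed

text \<open>Equality in distribution makes the mean and covariance of the vectorized matrix
  invariant under \<open>Q \<otimes>\<^sub>K Q\<close>. The forms they induce on test matrices are
  then invariant under orthogonal conjugation and fall under the classification.\<close>

lemma radial_type_mean_covariance:
  fixes R :: "'w \<Rightarrow> real^'k^'k"
  assumes P: "prob_space P" and R[measurable]: "R \<in> borel_measurable P"
    and radial: "radial_type P R"
    and mom: "first_two_moments_exist P (\<lambda>\<omega>. vectorize (R \<omega>))"
  obtains \<eta> \<alpha> \<beta> where "\<alpha> \<ge> 0" "\<alpha> + real CARD('k) * \<beta> \<ge> 0"
    "\<And>A. symmetric_matrix A \<Longrightarrow>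
      vectorize A \<bullet> mean_vector P (\<lambda>\<omega>. vectorize (R \<omega>)) = \<eta> * trace A"
    "\<And>A B. symmetric_matrix A \<Longrightarrow> symmetric_matrix B \<Longrightarrow>
      vectorize A \<bullet> (covariance_matrix P (\<lambda>\<omega>. vectorize (R \<omega>)) *v vectorize B)
        = \<alpha> * (A \<bullet> B) + \<beta> * (trace A * trace B)"
proof -
  let ?X = "\<lambda>\<omega>. vectorize (R \<omega>)"
  let ?\<mu> = "mean_vector P ?X" and ?C = "covariance_matrix P ?X"
  have cont: "f \<in> borel_measurable borel" if "linear f"
    for f :: "real^'k^'k \<Rightarrow> 'b::euclidean_space"
    using that by (intro borel_measurable_continuous_onI linear_continuous_on) (simp add: linear_linear)
  have vec_meas[measurable]: "(vectorize :: real^'k^'k \<Rightarrow> _) \<in> borel_measurable borel"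
    by (rule cont[OF vectorize_linear])
  have inv: "(Q \<otimes>\<^sub>K Q) *v ?\<mu> = ?\<mu>" "(Q \<otimes>\<^sub>K Q) ** ?C ** transpose (Q \<otimes>\<^sub>K Q) = ?C"
    if Q: "orthogonal_matrix Q" for Q :: "real^'k^'k"
  proof -
    have conj_meas[measurable]: "(\<lambda>A. Q ** A ** transpose Q) \<in> borel_measurable borel"
      by (rule cont, rule linearI)
        (simp_all add: matrix_add_ldistrib matrix_add_rdistrib matrix_scalar_ac scalar_matrix_assoc)
    have eq: "distr P borel (\<lambda>\<omega>. vectorize (Q ** R \<omega> ** transpose Q)) = distr P borel ?X"
    proof -
      have "distr P borel (\<lambda>\<omega>. vectorize (Q ** R \<omega> ** transpose Q))
          = distr (distr P borel (\<lambda>\<omega>. Q ** R \<omega> ** transpose Q)) borel vectorize"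
        by (subst distr_distr) (auto simp: comp_def)
      also have "\<dots> = distr (distr P borel R) borel vectorize"
        using radial Q by (simp add: radial_type_def)
      also have "\<dots> = distr P borel ?X"
        by (subst distr_distr) (auto simp: comp_def)
      finally show ?thesis .
    qed
    have lin: "vectorize (Q ** R \<omega> ** transpose Q) = (Q \<otimes>\<^sub>K Q) *v ?X \<omega>" for \<omega>
      by (simp add: kronecker_mult_vectorize)
    have meas: "(\<lambda>\<omega>. vectorize (Q ** R \<omega> ** transpose Q)) \<in> borel_measurable P"
      "?X \<in> borel_measurable P"
      by measurable
    show "(Q \<otimes>\<^sub>K Q) *v ?\<mu> = ?\<mu>"
      using mean_covariance_distr_cong(1)[OF meas eq] mean_vector_matrix_vector_mult[OF P mom lin]
      by simp
    show "(Q \<otimes>\<^sub>K Q) ** ?C ** transpose (Q \<otimes>\<^sub>K Q) = ?C"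
      using mean_covariance_distr_cong(2)[OF meas eq] covariance_matrix_vector_mult[OF P mom lin]
      by simp
  qed
  \<comment> \<open>Moves the conjugation from the random matrix to the test matrix by passing to
    the adjoint.\<close>
  have conj: "vectorize (transpose Q ** A ** Q) = transpose (Q \<otimes>\<^sub>K Q) *v vectorize A"
    for Q A :: "real^'k^'k"
    by (simp only: transpose_kronecker kronecker_mult_vectorize transpose_transpose)
  have "linear (\<lambda>A. vectorize A \<bullet> ?\<mu>)"
    by (rule linearI) (simp_all add: linear_add[OF vectorize_linear]
        linear_scale[OF vectorize_linear] inner_add_left)
  moreover have "vectorize (transpose Q ** A ** Q) \<bullet> ?\<mu> = vectorize A \<bullet> ?\<mu>"
    if "orthogonal_matrix Q" for Q A :: "real^'k^'k"
    by (simp only: conj inner_matrix_vector_transpose[symmetric] inv[OF that])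
  ultimately have "\<exists>\<eta>. \<forall>A. symmetric_matrix A \<longrightarrow> vectorize A \<bullet> ?\<mu> = \<eta> * trace A"
    by (rule invariant_linear_form)
  then obtain \<eta> where \<eta>: "\<And>A. symmetric_matrix A \<Longrightarrow> vectorize A \<bullet> ?\<mu> = \<eta> * trace A"
    by blast
  define c where "c A B = vectorize A \<bullet> (?C *v vectorize B)" for A B :: "real^'k^'k"
  have "bilinear c"
    unfolding bilinear_def c_def
    by (auto intro!: linearI simp: linear_add[OF vectorize_linear] linear_scale[OF vectorize_linear]
        inner_add_left inner_add_right matrix_vector_right_distrib matrix_vector_mult_scaleR)
  moreover have "c A B = c B A" for A B
    by (simp add: c_def covariance_matrix_inner[OF P mom] mult.commute)
  moreover have "c A A \<ge> 0" for A
    by (simp add: c_def covariance_matrix_inner[OF P mom])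
  moreover have "c (transpose Q ** A ** Q) (transpose Q ** B ** Q) = c A B"
    if "orthogonal_matrix Q" for Q A B
  proof -
    have "c (transpose Q ** A ** Q) (transpose Q ** B ** Q)
        = vectorize A \<bullet> (((Q \<otimes>\<^sub>K Q) ** ?C ** transpose (Q \<otimes>\<^sub>K Q)) *v vectorize B)"
      by (simp only: c_def conj inner_matrix_vector_transpose[of _ "Q \<otimes>\<^sub>K Q", symmetric]
          matrix_vector_mul_assoc matrix_mul_assoc
          inner_matrix_vector_transpose[of "vectorize A" "Q \<otimes>\<^sub>K Q", symmetric])
    then show ?thesis by (simp only: inv[OF that] c_def)
  qed
  ultimately have "\<exists>\<alpha> \<beta>. \<alpha> \<ge> 0 \<and> \<alpha> + real CARD('k) * \<beta> \<ge> 0 \<and>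
    (\<forall>A B. symmetric_matrix A \<longrightarrow> symmetric_matrix B \<longrightarrow>
      c A B = \<alpha> * (A \<bullet> B) + \<beta> * (trace A * trace B))"
    by (rule invariant_bilinear_form)
  then obtain \<alpha> \<beta> where "\<alpha> \<ge> 0" "\<alpha> + real CARD('k) * \<beta> \<ge> 0"
    "\<And>A B. symmetric_matrix A \<Longrightarrow> symmetric_matrix B \<Longrightarrow>
      c A B = \<alpha> * (A \<bullet> B) + \<beta> * (trace A * trace B)"
    by blast
  then show thesis
    using that[of \<alpha> \<beta> \<eta>] \<eta> unfolding c_def by blast
qed

text \<open>The matrix is the square of the symmetric \<open>B \<otimes>\<^sub>K B\<close>, so its
  quadratic form at a vectorized X is the squared norm of B X B, which is nonzero for nonzero X
  because \<open>B\<close> is invertible.\<close>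

lemma spd_kronecker_square:
  assumes B: "spd_matrix B"
  shows "spd_matrix ((B ** B) \<otimes>\<^sub>K (B ** B))"
proof -
  have sym: "transpose B = B"
    using B by (simp add: spd_matrix_def symmetric_matrix_def)
  have "vectorize X \<bullet> (((B ** B) \<otimes>\<^sub>K (B ** B)) *v vectorize X) > 0" if "vectorize X \<noteq> 0" for X
  proof -
    have "B ** X ** B \<noteq> 0"
    proof
      assume "B ** X ** B = 0"
      then have "(matrix_inv B ** B) ** X ** (B ** matrix_inv B) = 0"
        by (metis matrix_mul_assoc times0_left times0_right)
      with that show False
        by (simp add: matrix_inv_invertible[OF spd_matrix_invertible[OF B]]
            linear_0[OF vectorize_linear])
    qed
    then have "(B ** X ** B) \<bullet> (B ** X ** B) > 0" by simp
    also have "(B ** X ** B) \<bullet> (B ** X ** B) = vectorize (B ** X ** B) \<bullet> vectorize (B ** X ** B)"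
      by (simp only: inner_vectorize)
    also have "\<dots> = vectorize X \<bullet> (((B \<otimes>\<^sub>K B) ** (B \<otimes>\<^sub>K B)) *v vectorize X)"
      using kronecker_mult_vectorize[of B B X]
      by (simp only: sym matrix_vector_mul_assoc[symmetric]
          inner_matrix_vector_transpose[of "vectorize X" "B \<otimes>\<^sub>K B"] transpose_kronecker)
    finally show ?thesis by (simp only: kronecker_mult)
  qed
  then show ?thesis
    unfolding spd_matrix_def symmetric_matrix_def
    by (metis matrix_transpose_mul sym transpose_kronecker vectorize_surj)
qed

section \<open>Moments of the projected matrix and of its coefficient vector\<close>

theorem theorem1:
  fixes P :: "'w measure"
    and Ls :: "'l::finite \<Rightarrow> real^'k^'k"
    and L :: "real^'l^('k \<times> 'k)"
    and \<Sigma> :: "real^'k^'k"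
    and W :: "real^('k \<times> 'k)^('k \<times> 'k)"
    and \<theta> :: "real^'l"
    and N M :: "'w \<Rightarrow> real^'k^'k"
  assumes "prob_space P"
    and "\<And>j. symmetric_matrix (Ls j)"
    and L_def: "L = design_matrix Ls"
    and "rank L = CARD('l)"
    and "spd_matrix \<Sigma>"
    and "\<Sigma> = linear_structure Ls \<theta>"
    and "N \<in> borel_measurable P"
    and "radial_type_wrt P \<Sigma> N"
    and W_def: "W = matrix_inv \<Sigma> \<otimes>\<^sub>K matrix_inv \<Sigma>"
    and "\<And>\<omega>. \<omega> \<in> space P \<Longrightarrow> vectorize (M \<omega>) = scaled_projection W L (vectorize (N \<omega>))"
    and "first_two_moments_exist P (\<lambda>\<omega>. vectorize (N \<omega>))"
  shows "\<exists>\<eta> \<sigma>1 \<sigma>2 :: real.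
    \<sigma>1 \<ge> 0 \<and> \<sigma>2 \<ge> - 2 * \<sigma>1 / real CARD('k) \<and>
    first_two_moments_exist P (\<lambda>\<omega>. vectorize (M \<omega>)) \<and>
    mean_vector P (\<lambda>\<omega>. vectorize (M \<omega>)) = \<eta> *\<^sub>R vectorize \<Sigma> \<and>
    covariance_matrix P (\<lambda>\<omega>. vectorize (M \<omega>)) =
      (2 * \<sigma>1) *\<^sub>R (L ** matrix_inv (transpose L ** W ** L) ** transpose L)
      + \<sigma>2 *\<^sub>R outer_product (vectorize \<Sigma>) (vectorize \<Sigma>) \<and>
    (\<forall>T :: 'w \<Rightarrow> real^'l.
      (\<forall>\<omega>\<in>space P. vectorize (M \<omega>) = L *v T \<omega>) \<longrightarrow>
        first_two_moments_exist P T \<and>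
        mean_vector P T = \<eta> *\<^sub>R \<theta> \<and>
        covariance_matrix P T =
          (2 * \<sigma>1) *\<^sub>R matrix_inv (transpose L ** W ** L)
          + \<sigma>2 *\<^sub>R outer_product \<theta> \<theta>)"
proof -
  note P = assms(1)
  define B where "B = inv_sqrt_matrix \<Sigma>"
  \<comment> \<open>The basis matrices after whitening by \<open>B\<close>. The rows of
    \<open>F\<close> are their vectorizations, so \<open>F\<close> acts on the vectorized
    \<open>R\<close> by taking inner products with the \<open>K j\<close>.\<close>
  define K where "K j = B ** Ls j ** B" for j
  define F where "F = transpose (design_matrix K)"
  define R where "R \<omega> = B ** N \<omega> ** B" for \<omega>
  define G where "G = transpose L ** W ** L"
  have B: "spd_matrix B" and BB: "B ** B = matrix_inv \<Sigma>"
    using inv_sqrt_matrix[OF assms(5)] by (simp_all add: B_def)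
  have BT: "transpose B = B"
    using B by (simp add: spd_matrix_def symmetric_matrix_def)
  have "B ** (B ** \<Sigma>) = mat 1"
    by (simp add: matrix_mul_assoc BB matrix_inv_invertible spd_matrix_invertible assms(5))
  \<comment> \<open>A right inverse of a square matrix is also a left inverse, applied to
    \<open>B\<close> and \<open>B ** \<Sigma>\<close>.\<close>
  then have B\<Sigma>B: "B ** \<Sigma> ** B = mat 1"
    by (simp add: matrix_left_right_inverse)
  have W: "W = (B \<otimes>\<^sub>K B) ** (B \<otimes>\<^sub>K B)"
    by (simp add: W_def BB kronecker_mult)
  have spdW: "spd_matrix W"
    using spd_kronecker_square[OF B] by (simp add: W kronecker_mult)
  have injL: "inj ((*v) L)"
    using assms(4) by (simp add: full_rank_injective)
  have G: "spd_matrix G" unfolding G_def by (rule spd_gram[OF spdW injL])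
  note G_inv = matrix_inv_invertible[OF spd_matrix_invertible[OF G]]
  have GT: "transpose (matrix_inv G) = matrix_inv G"
    using spd_matrix_inv[OF G] by (simp add: spd_matrix_def symmetric_matrix_def)
  have symK: "symmetric_matrix (K j)" for j
    using assms(2)[of j] BT
    by (simp add: K_def symmetric_matrix_def matrix_transpose_mul matrix_mul_assoc)
  have F: "F = transpose L ** (B \<otimes>\<^sub>K B)"
  proof -
    have "F *v x = (transpose L ** (B \<otimes>\<^sub>K B)) *v x" for x
    proof -
      obtain X where x: "x = vectorize X" using vectorize_surj by blast
      have "(F *v x) $ j = ((transpose L ** (B \<otimes>\<^sub>K B)) *v x) $ j" for j
      proof -
        have "((transpose L ** (B \<otimes>\<^sub>K B)) *v x) $ j = Ls j \<bullet> (B ** X ** B)"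
          by (simp only: matrix_vector_mul_assoc[symmetric] x kronecker_mult_vectorize BT L_def
              transpose_design_matrix_mult)
        also have "\<dots> = K j \<bullet> X"
          by (simp only: inner_matrix_mult_right[of _ "B ** X" B] inner_matrix_mult_left[of _ B X]
              BT K_def matrix_mul_assoc)
        finally show ?thesis by (simp only: x F_def transpose_design_matrix_mult)
      qed
      then show ?thesis by (simp add: vec_eq_iff)
    qed
    then show ?thesis by (simp add: matrix_eq)
  qed
  \<comment> \<open>Splitting \<open>W\<close> as a square makes \<open>G\<close> the Gram matrix of
    the \<open>K j\<close> in the Frobenius product.\<close>
  have FF: "G = F ** transpose F"
    by (simp only: G_def F W matrix_transpose_mul transpose_transpose transpose_kronecker BT
        matrix_mul_assoc)
  have F_row: "F $ j = vectorize (K j)" for j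
    by (simp add: F_def vec_eq_iff transpose_def design_matrix_def)
  have G_comp: "G $ i $ j = K i \<bullet> K j" for i j
    using matrix_mult_conjugate_component[of F "mat 1" i j]
    by (simp add: FF F_row inner_vectorize)
  have vecR: "vectorize (R \<omega>) = (B \<otimes>\<^sub>K B) *v vectorize (N \<omega>)" for \<omega>
    by (simp only: R_def kronecker_mult_vectorize BT)
  \<comment> \<open>Since L \<theta> vectorizes \<Sigma> and whitening turns \<Sigma> into the
    identity, the components are inner products of \<open>K j\<close> with the identity.\<close>
  have trK: "G *v \<theta> = (\<chi> j. trace (K j))"
  proof -
    have "G *v \<theta> = F *v vectorize (B ** \<Sigma> ** B)"
      using kronecker_mult_vectorize[of B B \<Sigma>] design_matrix_mult[of Ls \<theta>]
      by (simp only: G_def W F L_def assms(6)[symmetric] matrix_vector_mul_assoc[symmetric]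
          matrix_mul_assoc[symmetric] BT)
    also have "\<dots> = (\<chi> j. trace (K j))"
      by (simp add: vec_eq_iff B\<Sigma>B F_def transpose_design_matrix_mult inner_mat_1
          del: transpose_matrix_vector)
    finally show ?thesis .
  qed
  have momR: "first_two_moments_exist P (\<lambda>\<omega>. vectorize (R \<omega>))"
    by (rule first_two_moments_matrix_vector_mult[OF P assms(11) vecR])
  have measR: "R \<in> borel_measurable P"
  proof -
    have "linear (\<lambda>X. B ** X ** B)"
      by (rule linearI)
        (simp_all add: matrix_add_ldistrib matrix_add_rdistrib matrix_scalar_ac scalar_matrix_assoc)
    then have "(\<lambda>X. B ** X ** B) \<in> borel_measurable borel"
      by (intro borel_measurable_continuous_onI linear_continuous_on) (simp add: linear_linear)
    from measurable_compose[OF assms(7) this] show ?thesis by (simp add: R_def[abs_def])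
  qed
  have radial: "radial_type P R"
    using assms(8) by (simp add: radial_type_wrt_def B_def R_def[abs_def])
  obtain \<eta> \<alpha> \<beta> where \<alpha>\<beta>: "\<alpha> \<ge> 0" "\<alpha> + real CARD('k) * \<beta> \<ge> 0"
    and mean: "\<And>A. symmetric_matrix A \<Longrightarrow>
      vectorize A \<bullet> mean_vector P (\<lambda>\<omega>. vectorize (R \<omega>)) = \<eta> * trace A"
    and cov: "\<And>A B. symmetric_matrix A \<Longrightarrow> symmetric_matrix B \<Longrightarrow>
      vectorize A \<bullet> (covariance_matrix P (\<lambda>\<omega>. vectorize (R \<omega>)) *v vectorize B)
        = \<alpha> * (A \<bullet> B) + \<beta> * (trace A * trace B)"
    by (rule radial_type_mean_covariance[OF P measR radial momR]) blast
  \<comment> \<open>The least-squares coefficients, expressed through \<open>R\<close> so that their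
    moments are linear images of those of a matrix of radial type.\<close>
  define T0 where "T0 \<omega> = (matrix_inv G ** F) *v vectorize (R \<omega>)" for \<omega>
  note T0 = moments_matrix_vector_mult[OF P momR T0_def]
  have "F *v mean_vector P (\<lambda>\<omega>. vectorize (R \<omega>)) = \<eta> *\<^sub>R (G *v \<theta>)"
    by (simp add: vec_eq_iff matrix_vector_mul_component F_row mean symK trK)
  then have meanT0: "mean_vector P T0 = \<eta> *\<^sub>R \<theta>"
    unfolding T0(2)
    by (simp add: matrix_vector_mul_assoc[symmetric] matrix_vector_mult_scaleR)
      (simp add: matrix_vector_mul_assoc G_inv)
  have FCF: "F ** covariance_matrix P (\<lambda>\<omega>. vectorize (R \<omega>)) ** transpose F
      = \<alpha> *\<^sub>R G + \<beta> *\<^sub>R outer_product (G *v \<theta>) (G *v \<theta>)"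
    by (simp add: vec_eq_iff matrix_mult_conjugate_component F_row cov symK G_comp trK
        outer_product_def)
  have "covariance_matrix P T0
      = matrix_inv G ** (\<alpha> *\<^sub>R G + \<beta> *\<^sub>R outer_product (G *v \<theta>) (G *v \<theta>)) ** transpose (matrix_inv G)"
    by (simp only: T0(3) FCF[symmetric] matrix_transpose_mul matrix_mul_assoc)
  \<comment> \<open>Conjugation by the symmetric inverse of \<open>G\<close> turns \<open>G\<close>
    into its inverse and sends \<open>G *v \<theta>\<close> back to \<theta>.\<close>
  also have "\<dots> = \<alpha> *\<^sub>R matrix_inv G + \<beta> *\<^sub>R outer_product \<theta> \<theta>"
    unfolding matrix_add_conjugate outer_product_conjugate
    by (simp add: matrix_vector_mul_assoc G_inv GT)
  finally have covT0: "covariance_matrix P T0 = \<alpha> *\<^sub>R matrix_inv G + \<beta> *\<^sub>R outer_product \<theta> \<theta>" .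
  have MT: "vectorize (M \<omega>) = L *v T0 \<omega>" if "\<omega> \<in> space P" for \<omega>
  proof -
    have "transpose L *v (W *v vectorize (N \<omega>)) = F *v vectorize (R \<omega>)"
      by (simp only: vecR F W matrix_vector_mul_assoc matrix_mul_assoc)
    then show ?thesis
      using scaled_projection_normal_equations[OF spdW injL, of "vectorize (N \<omega>)"]
      by (simp only: assms(10)[OF that] T0_def G_def matrix_vector_mul_assoc[symmetric])
  qed
  note M = moments_matrix_vector_mult[OF P T0(1) MT]
  have L\<theta>: "L *v \<theta> = vectorize \<Sigma>"
    by (simp add: L_def design_matrix_mult assms(6))
  have meanM: "mean_vector P (\<lambda>\<omega>. vectorize (M \<omega>)) = \<eta> *\<^sub>R vectorize \<Sigma>"
    by (simp only: M(2) meanT0 matrix_vector_mult_scaleR L\<theta>)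
  have covM: "covariance_matrix P (\<lambda>\<omega>. vectorize (M \<omega>))
      = \<alpha> *\<^sub>R (L ** matrix_inv G ** transpose L) + \<beta> *\<^sub>R outer_product (vectorize \<Sigma>) (vectorize \<Sigma>)"
    by (simp only: M(3) covT0 matrix_add_conjugate outer_product_conjugate L\<theta>)
  have T: "first_two_moments_exist P T \<and> mean_vector P T = \<eta> *\<^sub>R \<theta> \<and>
      covariance_matrix P T = \<alpha> *\<^sub>R matrix_inv G + \<beta> *\<^sub>R outer_product \<theta> \<theta>"
    if "\<forall>\<omega>\<in>space P. vectorize (M \<omega>) = L *v T \<omega>" for T
  proof -
    \<comment> \<open>Injectivity of \<open>L\<close> forces \<open>T\<close> to agree with
      \<open>T0\<close> on \<open>space P\<close>; the identity matrix puts this in the shape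
      required for transferring moments.\<close>
    have "T \<omega> = mat 1 *v T0 \<omega>" if \<omega>: "\<omega> \<in> space P" for \<omega>
      using MT[OF \<omega>] \<omega> \<open>\<forall>\<omega>\<in>space P. vectorize (M \<omega>) = L *v T \<omega>\<close> injL
      by (simp add: inj_eq)
    from moments_matrix_vector_mult[OF P T0(1) this] show ?thesis
      by (simp add: meanT0 covT0)
  qed
  show ?thesis
  \<comment> \<open>Halving \<alpha> absorbs the factor 2 in the covariance formula; the bound on
    \<sigma>2 is then \<alpha> + k \<beta> \<ge> 0 divided by k.\<close>
  proof (rule exI[of _ \<eta>], rule exI[of _ "\<alpha> / 2"], rule exI[of _ \<beta>], intro conjI allI impI)
    show "\<alpha> / 2 \<ge> 0" using \<alpha>\<beta> by simp
    show "\<beta> \<ge> - 2 * (\<alpha> / 2) / real CARD('k)"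
      using \<alpha>\<beta>(2) by (simp add: field_simps)
  qed (use M(1) meanM covM T in \<open>simp_all add: G_def\<close>)
qed

end
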